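(* Let $A\colon E \supseteq D(A) \to E$ be a linear operator on a complex Banach lattice $E$ and let $\lambda_0 \in \sigma(A) \cap \mathbb{R}$ be a pole of the resolvent $\mathcal{R}(\,\cdot\,,A)$. Suppose that for every $f \in E_+$ we have $$(\lambda - \lambda_0)\operatorname{dist}(\mathcal{R}(\lambda,A)f, E_+) \to 0 \quad \text{as } \lambda \downarrow \lambda_0.$$ Then the following assertions hold: (i) The number $\lambda_0$ is an eigenvalue of $A$ and the corresponding eigenspace $\ker(\lambda_0 I - A)$ contains a positive, non-zero vector. (ii) If $A$ is densely defined, then $\lambda_0$ is an eigenvalue of the dual operator $A'$ and the corresponding eigenspace $\ker(\lambda_0 I - A')$ contains a positive, non-zero vector.
   Context: $E_+$ denotes the positive cone of $E$; a vector $f \in E$ is positive if $f \ge 0$, i.e. $f \in E_+$. For $\lambda$ in the resolvent set $\rho(A)$, $\mathcal{R}(\lambda,A) := (\lambda I - A)^{-1}$ is the resolvent, an analytic map on $\rho(A)$; $\sigma(A)$ is the spectrum of $A$. The limit $\lambda \downarrow \lambda_0$ is taken along real $\lambda > \lambda_0$. $\operatorname{dist}$ denotes the distance of a point to a set with respect to the norm of $E$. The dual space $E'$ is a Banach lattice with positive cone $E'_+$ (a functional $\varphi \in E'$ is positive iff $\langle \varphi, f\rangle \ge 0$ for all $0 \le f \in E$), and $A'\colon E' \supseteq D(A') \to E'$ is the dual operator of the densely defined operator $A$. *)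

theory Defs
  imports "HOL-Analysis.Analysis" "HOL-Library.Lattice_Algebras" "HOL-Library.Nonpos_Ints"
begin

section \<open>Complex normed spaces\<close>

class complex_normed_vector = real_normed_vector +
  fixes scaleC :: "complex \<Rightarrow> 'a \<Rightarrow> 'a"  (infixr \<open>*\<^sub>C\<close> 75)
  assumes scaleC_add_right: "c *\<^sub>C (x + y) = c *\<^sub>C x + c *\<^sub>C y"
    and scaleC_add_left: "(c + d) *\<^sub>C x = c *\<^sub>C x + d *\<^sub>C x"
    and scaleC_scaleC: "c *\<^sub>C d *\<^sub>C x = (c * d) *\<^sub>C x"
    and scaleC_of_real: "of_real r *\<^sub>C x = r *\<^sub>R x"
    and norm_scaleC: "norm (c *\<^sub>C x) = cmod c * norm x"

lemma scaleC_one: "1 *\<^sub>C x = (x :: 'a::complex_normed_vector)"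
  using scaleC_of_real[of 1 x] by simp

interpretation complex_vector: vector_space "scaleC :: complex \<Rightarrow> 'a \<Rightarrow> 'a::complex_normed_vector"
  by unfold_locales (simp_all add: scaleC_add_right scaleC_add_left scaleC_scaleC scaleC_one)

instantiation complex :: complex_normed_vector
begin

definition scaleC_complex :: "complex \<Rightarrow> complex \<Rightarrow> complex" where
  "scaleC_complex c x = c * x"

instance
  by standard
    (simp_all add: scaleC_complex_def algebra_simps norm_mult scaleR_conv_of_real)

end

lemma bounded_linear_scaleC_right: "bounded_linear (scaleC c :: 'a \<Rightarrow> 'a::complex_normed_vector)"
proof (rule bounded_linear_intro[where K = "cmod c"])
  fix r and x :: 'a
  show "c *\<^sub>C r *\<^sub>R x = r *\<^sub>R c *\<^sub>C x"
    by (metis scaleC_of_real scaleC_scaleC mult.commute)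
qed (simp_all add: scaleC_add_right norm_scaleC)

instantiation blinfun :: (real_normed_vector, complex_normed_vector) complex_normed_vector
begin

definition scaleC_blinfun :: "complex \<Rightarrow> ('a \<Rightarrow>\<^sub>L 'b) \<Rightarrow> 'a \<Rightarrow>\<^sub>L 'b" where
  "scaleC_blinfun c T = Blinfun (\<lambda>x. c *\<^sub>C blinfun_apply T x)"

lemma blinfun_apply_scaleC [simp]:
  "blinfun_apply (c *\<^sub>C T) x = c *\<^sub>C blinfun_apply T x"
  unfolding scaleC_blinfun_def
  by (rule fun_cong[OF bounded_linear_Blinfun_apply[OF bounded_linear_compose]])
    (intro bounded_linear_scaleC_right blinfun.bounded_linear_right)+

instance
proof
  fix c d :: complex and r :: real and S T :: "'a \<Rightarrow>\<^sub>L 'b"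
  show "c *\<^sub>C (S + T) = c *\<^sub>C S + c *\<^sub>C T" "(c + d) *\<^sub>C T = c *\<^sub>C T + d *\<^sub>C T"
    "c *\<^sub>C d *\<^sub>C T = (c * d) *\<^sub>C T" "of_real r *\<^sub>C T = r *\<^sub>R T"
    by (rule blinfun_eqI, simp add: blinfun.add_left blinfun.scaleR_left scaleC_add_right
        scaleC_add_left scaleC_scaleC scaleC_of_real)+
  have le: "norm (e *\<^sub>C U) \<le> cmod e * norm U" for e and U :: "'a \<Rightarrow>\<^sub>L 'b"
  proof (rule norm_blinfun_bound)
    fix x
    show "norm (blinfun_apply (e *\<^sub>C U) x) \<le> cmod e * norm U * norm x"
      by (simp add: norm_scaleC mult.assoc mult_left_mono norm_blinfun)
  qed simp
  show "norm (c *\<^sub>C T) = cmod c * norm T"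
  proof (cases "c = 0")
    case True
    have "0 *\<^sub>C T = 0" by (rule blinfun_eqI) simp
    with True show ?thesis by simp
  next
    case False
    have "inverse c *\<^sub>C c *\<^sub>C T = T"
      using False by (intro blinfun_eqI) (simp add: scaleC_scaleC scaleC_one)
    then have "norm T \<le> cmod (inverse c) * norm (c *\<^sub>C T)"
      by (metis le)
    then have "cmod c * norm T \<le> norm (c *\<^sub>C T)"
      using False by (simp add: norm_inverse norm_divide field_simps)
    with le[of c T] show ?thesis by simp
  qed
qed

end


section \<open>Real Banach lattices\<close>

class banach_lattice = banach + ordered_real_vector + lattice_ab_group_add_abs +
  assumes norm_lattice_mono: "\<bar>x\<bar> \<le> \<bar>y\<bar> \<Longrightarrow> norm x \<le> norm y"

instance real :: banach_lattice
  by standard (simp_all add: abs_real_def sup_real_def)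

lemma norm_abs_lattice [simp]: "norm \<bar>x\<bar> = norm (x :: 'a::banach_lattice)"
  by (intro antisym norm_lattice_mono) simp_all

lemma norm_mono_pos: "0 \<le> x \<Longrightarrow> x \<le> y \<Longrightarrow> norm x \<le> norm (y :: 'a::banach_lattice)"
  by (intro norm_lattice_mono) (metis abs_of_nonneg order_trans)

lemma abs_le_lattice: "x \<le> y \<Longrightarrow> - x \<le> y \<Longrightarrow> \<bar>x\<bar> \<le> (y :: 'a::banach_lattice)"
  by (simp add: abs_lattice)

lemma abs_scaleR_le: "\<bar>r *\<^sub>R x\<bar> \<le> \<bar>r\<bar> *\<^sub>R \<bar>x :: 'a::banach_lattice\<bar>"
proof (cases "0 \<le> r")
  case True
  then show ?thesis
    using scaleR_left_mono[OF abs_ge_self, of r x] scaleR_left_mono[OF abs_ge_minus_self, of r x]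
    by (intro abs_le_lattice) auto
next
  case False
  then show ?thesis
    using scaleR_left_mono[OF abs_ge_self, of "- r" x]
      scaleR_left_mono[OF abs_ge_minus_self, of "- r" x]
    by (intro abs_le_lattice) auto
qed

lemma pos_cone_limit:
  fixes X :: "nat \<Rightarrow> 'a::banach_lattice"
  assumes lim: "X \<longlonglongrightarrow> x" and pos: "\<And>n. 0 \<le> X n"
  shows "0 \<le> x"
proof -
  have bound: "norm (sup (- x) 0) \<le> norm (X n - x)" for n
  proof -
    have "- x \<le> X n - x" using pos[of n] by simp
    also have "\<dots> \<le> \<bar>X n - x\<bar>" by (rule abs_ge_self)
    finally have "sup (- x) 0 \<le> \<bar>X n - x\<bar>" by simp
    then show ?thesis
      using norm_mono_pos[of "sup (- x) 0" "\<bar>X n - x\<bar>"] by simp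
  qed
  have "(\<lambda>n. norm (X n - x)) \<longlonglongrightarrow> 0"
    using lim by (simp add: LIM_zero tendsto_norm_zero)
  then have "norm (sup (- x) 0) \<le> 0"
    by (rule LIMSEQ_le_const) (use bound in blast)
  then have "sup (- x) 0 = 0" by simp
  then have "- x \<le> 0" by (metis sup.cobounded1)
  then show ?thesis by simp
qed


section \<open>The complexification of a real Banach lattice\<close>

datatype 'a complexification = Cpx (re_part: 'a) (im_part: 'a)

lemma complexification_eqI:
  "re_part z = re_part w \<Longrightarrow> im_part z = im_part w \<Longrightarrow> z = w"
  by (rule complexification.expand) simp

definition rotated_re :: "'a::banach_lattice complexification \<Rightarrow> real \<Rightarrow> 'a" where
  "rotated_re z t = cos t *\<^sub>R re_part z + sin t *\<^sub>R im_part z"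

text \<open>The modulus of \<open>x + iy\<close> is the least upper bound of
  \<open>(cos t) x + (sin t) y\<close> over all real \<open>t\<close>; it exists in every Banach lattice,
  even though the order need not be complete.\<close>

definition modulus :: "'a::banach_lattice complexification \<Rightarrow> 'a" where
  "modulus z = (THE m. (\<forall>t. rotated_re z t \<le> m) \<and> (\<forall>v. (\<forall>t. rotated_re z t \<le> v) \<longrightarrow> m \<le> v))"

lemma rotated_re_near:
  "rotated_re z s \<le> rotated_re z t + \<bar>s - t\<bar> *\<^sub>R (\<bar>re_part z\<bar> + \<bar>im_part z\<bar>)"
proof -
  have c: "\<bar>cos s - cos t\<bar> \<le> \<bar>s - t\<bar>"
  proof -
    have "\<bar>cos s - cos t\<bar> = 2 * (\<bar>sin ((s + t) / 2)\<bar> * \<bar>sin ((t - s) / 2)\<bar>)"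
      by (simp add: cos_diff_cos abs_mult)
    also have "\<dots> \<le> 2 * (1 * \<bar>(t - s) / 2\<bar>)"
      by (intro mult_left_mono mult_mono abs_sin_le_one abs_sin_x_le_abs_x) auto
    finally show ?thesis by simp
  qed
  have s: "\<bar>sin s - sin t\<bar> \<le> \<bar>s - t\<bar>"
  proof -
    have "\<bar>sin s - sin t\<bar> = 2 * (\<bar>sin ((s - t) / 2)\<bar> * \<bar>cos ((s + t) / 2)\<bar>)"
      by (simp add: sin_diff_sin abs_mult)
    also have "\<dots> \<le> 2 * (\<bar>(s - t) / 2\<bar> * 1)"
      by (intro mult_left_mono mult_mono abs_cos_le_one abs_sin_x_le_abs_x) auto
    finally show ?thesis by simp
  qed
  have "r *\<^sub>R x \<le> \<bar>s - t\<bar> *\<^sub>R \<bar>x\<bar>" if "\<bar>r\<bar> \<le> \<bar>s - t\<bar>" for r and x :: 'a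
  proof -
    have "r *\<^sub>R x \<le> \<bar>r *\<^sub>R x\<bar>" by (rule abs_ge_self)
    also have "\<dots> \<le> \<bar>r\<bar> *\<^sub>R \<bar>x\<bar>" by (rule abs_scaleR_le)
    also have "\<dots> \<le> \<bar>s - t\<bar> *\<^sub>R \<bar>x\<bar>" by (rule scaleR_right_mono[OF that]) simp
    finally show ?thesis .
  qed
  from add_mono[OF this[OF c, of "re_part z"] this[OF s, of "im_part z"]]
  have "rotated_re z s - rotated_re z t \<le> \<bar>s - t\<bar> *\<^sub>R (\<bar>re_part z\<bar> + \<bar>im_part z\<bar>)"
    by (simp add: rotated_re_def algebra_simps)
  then show ?thesis by (simp add: diff_le_eq add.commute)
qed

lemma modulus_exists:
  fixes z :: "'a::banach_lattice complexification"
  shows "\<exists>m. (\<forall>t. rotated_re z t \<le> m) \<and> (\<forall>v. (\<forall>t. rotated_re z t \<le> v) \<longrightarrow> m \<le> v)"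
proof -
  define u where "u = \<bar>re_part z\<bar> + \<bar>im_part z\<bar>"
  define F where "F n = (\<lambda>k. 2 * pi * real k / 2 ^ n) ` {..2 ^ n :: nat}" for n :: nat
  define e where "e n = 2 * pi / 2 ^ n" for n :: nat
  define m where "m n = Sup_fin (rotated_re z ` F n)" for n
  have u0: "0 \<le> u" by (simp add: u_def)
  have finF: "finite (rotated_re z ` F n)" "rotated_re z ` F n \<noteq> {}" for n
    by (auto simp: F_def)
  have e0: "0 < e n" for n by (simp add: e_def)
  have upper: "rotated_re z t \<le> m n + e n *\<^sub>R u" for t n
  proof -
    obtain s where s: "0 \<le> s" "s < 2 * pi" "cos t = cos s" "sin t = sin s"
      using sincos_total_2pi[of "cos t" "sin t"] by (auto simp: cos_squared_eq)
    define k where "k = nat \<lfloor>s / e n\<rfloor>"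
    have sk: "0 \<le> s / e n" using s e0[of n] by simp
    have k1: "real k \<le> s / e n" "s / e n < real k + 1"
      unfolding k_def using sk by (simp_all add: of_nat_nat)
    have "s / e n \<le> 2 ^ n" using s by (simp add: e_def field_simps)
    with k1 have "real k \<le> 2 ^ n" by linarith
    then have "k \<le> 2 ^ n" by simp
    then have inF: "real k * e n \<in> F n" unfolding F_def e_def by (auto simp: image_iff field_simps)
    have "\<bar>s - real k * e n\<bar> \<le> e n"
      using k1 e0[of n] by (simp add: field_simps abs_le_iff)
    then have "\<bar>s - real k * e n\<bar> *\<^sub>R u \<le> e n *\<^sub>R u" by (rule scaleR_right_mono) (rule u0)
    moreover have "rotated_re z (real k * e n) \<le> m n"
      unfolding m_def using inF finF by (intro Sup_fin.coboundedI) auto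
    moreover have "rotated_re z t = rotated_re z s" using s by (simp add: rotated_re_def)
    ultimately show ?thesis
      using rotated_re_near[of z s "real k * e n"] unfolding u_def[symmetric]
      by (metis add_mono order_trans)
  qed
  have least: "m n \<le> v" if "\<And>t. rotated_re z t \<le> v" for n v
    unfolding m_def using finF that by (intro Sup_fin.boundedI) auto
  have diff: "norm (m p - m n) \<le> (e n + e p) * norm u" for n p
  proof -
    have 1: "m p - m n \<le> e n *\<^sub>R u" "m n - m p \<le> e p *\<^sub>R u"
      using least[OF upper] by (simp_all add: diff_le_eq add.commute)
    have "e n *\<^sub>R u \<le> (e n + e p) *\<^sub>R u" "e p *\<^sub>R u \<le> (e n + e p) *\<^sub>R u"
      using e0[of n] e0[of p] u0 by (auto intro!: scaleR_right_mono)
    with 1 have "\<bar>m p - m n\<bar> \<le> (e n + e p) *\<^sub>R u"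
      by (intro abs_le_lattice) (auto intro: order_trans)
    then have "norm \<bar>m p - m n\<bar> \<le> norm ((e n + e p) *\<^sub>R u)"
      by (intro norm_mono_pos) auto
    then show ?thesis using e0[of n] e0[of p] by simp
  qed
  have e_lim: "e \<longlonglongrightarrow> 0"
    unfolding e_def by (rule LIMSEQ_divide_realpow_zero) simp
  have "Cauchy m"
  proof (rule CauchyI)
    fix d :: real assume d: "0 < d"
    have "(\<lambda>n. e n * norm u) \<longlonglongrightarrow> 0" using tendsto_mult_right[OF e_lim, of "norm u"] by simp
    then have "\<forall>\<^sub>F n in sequentially. e n * norm u < d / 2"
      using d by (intro order_tendstoD(2)[where y = 0]) auto
    then obtain N where N: "\<And>n. n \<ge> N \<Longrightarrow> e n * norm u < d / 2"
      by (auto simp: eventually_sequentially)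
    show "\<exists>M. \<forall>p\<ge>M. \<forall>n\<ge>M. norm (m p - m n) < d"
    proof (intro exI[of _ N] allI impI)
      fix p n assume "N \<le> p" "N \<le> n"
      with N[of p] N[of n] diff[of p n] show "norm (m p - m n) < d"
        by (simp add: distrib_right)
    qed
  qed
  then obtain l where l: "m \<longlonglongrightarrow> l" using Cauchy_convergent convergent_def by blast
  have "rotated_re z t \<le> l" for t
  proof -
    have "(\<lambda>n. m n + e n *\<^sub>R u - rotated_re z t) \<longlonglongrightarrow> l + 0 *\<^sub>R u - rotated_re z t"
      by (intro tendsto_intros l e_lim)
    then have "0 \<le> l + 0 *\<^sub>R u - rotated_re z t"
      by (rule pos_cone_limit) (use upper in simp)
    then show ?thesis by simp
  qed
  moreover have "l \<le> v" if "\<forall>t. rotated_re z t \<le> v" for v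
  proof -
    have "(\<lambda>n. v - m n) \<longlonglongrightarrow> v - l" by (intro tendsto_intros l)
    then have "0 \<le> v - l" by (rule pos_cone_limit) (use least that in simp)
    then show ?thesis by simp
  qed
  ultimately show ?thesis by blast
qed

lemma modulus_lub:
  fixes z :: "'a::banach_lattice complexification"
  shows "(\<forall>t. rotated_re z t \<le> modulus z) \<and> (\<forall>v. (\<forall>t. rotated_re z t \<le> v) \<longrightarrow> modulus z \<le> v)"
  unfolding modulus_def
proof (rule theI')
  show "\<exists>!m. (\<forall>t. rotated_re z t \<le> m) \<and> (\<forall>v. (\<forall>t. rotated_re z t \<le> v) \<longrightarrow> m \<le> v)"
    using modulus_exists[of z] by (auto intro: antisym)
qed

lemma modulus_upper: "rotated_re z t \<le> modulus z"
  using modulus_lub by blast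

lemma modulus_least: "(\<And>t. rotated_re z t \<le> v) \<Longrightarrow> modulus z \<le> v"
  using modulus_lub by blast

lemma abs_rotated_re_le: "\<bar>rotated_re z t\<bar> \<le> modulus z"
  using modulus_upper[of z t] modulus_upper[of z "t + pi"]
  by (intro abs_le_lattice) (simp_all add: rotated_re_def)

lemma abs_re_part_le: "\<bar>re_part z\<bar> \<le> modulus z"
  using abs_rotated_re_le[of z 0] by (simp add: rotated_re_def)

lemma abs_im_part_le: "\<bar>im_part z\<bar> \<le> modulus z"
  using abs_rotated_re_le[of z "pi / 2"] by (simp add: rotated_re_def)

lemma modulus_nonneg [simp]: "0 \<le> modulus z"
  using abs_re_part_le abs_ge_zero order_trans by blast

lemma modulus_le_sum: "modulus z \<le> \<bar>re_part z\<bar> + \<bar>im_part z\<bar>"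
proof (rule modulus_least)
  fix t
  have 1: "r *\<^sub>R x \<le> \<bar>x\<bar>" if "\<bar>r\<bar> \<le> 1" for r and x :: 'a
  proof -
    have "r *\<^sub>R x \<le> \<bar>r *\<^sub>R x\<bar>" by (rule abs_ge_self)
    also have "\<dots> \<le> \<bar>r\<bar> *\<^sub>R \<bar>x\<bar>" by (rule abs_scaleR_le)
    also have "\<dots> \<le> 1 *\<^sub>R \<bar>x\<bar>" by (rule scaleR_right_mono[OF that]) simp
    finally show ?thesis by simp
  qed
  show "rotated_re z t \<le> \<bar>re_part z\<bar> + \<bar>im_part z\<bar>"
    unfolding rotated_re_def by (intro add_mono 1) simp_all
qed

instantiation complexification :: (banach_lattice) complex_normed_vector
begin

definition zero_complexification :: "'a complexification" where
  "0 = Cpx 0 0"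

definition plus_complexification :: "'a complexification \<Rightarrow> 'a complexification \<Rightarrow> 'a complexification" where
  "z + w = Cpx (re_part z + re_part w) (im_part z + im_part w)"

definition minus_complexification :: "'a complexification \<Rightarrow> 'a complexification \<Rightarrow> 'a complexification" where
  "z - w = Cpx (re_part z - re_part w) (im_part z - im_part w)"

definition uminus_complexification :: "'a complexification \<Rightarrow> 'a complexification" where
  "- z = Cpx (- re_part z) (- im_part z)"

definition scaleR_complexification :: "real \<Rightarrow> 'a complexification \<Rightarrow> 'a complexification" where
  "r *\<^sub>R z = Cpx (r *\<^sub>R re_part z) (r *\<^sub>R im_part z)"

definition scaleC_complexification :: "complex \<Rightarrow> 'a complexification \<Rightarrow> 'a complexification" where
  "c *\<^sub>C z = Cpx (Re c *\<^sub>R re_part z - Im c *\<^sub>R im_part z) (Re c *\<^sub>R im_part z + Im c *\<^sub>R re_part z)"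

definition norm_complexification :: "'a complexification \<Rightarrow> real" where
  "norm z = norm (modulus z)"

definition dist_complexification :: "'a complexification \<Rightarrow> 'a complexification \<Rightarrow> real" where
  "dist_complexification z w = norm (z - w)"

definition sgn_complexification :: "'a complexification \<Rightarrow> 'a complexification" where
  "sgn_complexification z = inverse (norm z) *\<^sub>R z"

definition uniformity_complexification :: "('a complexification \<times> 'a complexification) filter" where
  "uniformity_complexification = (INF e\<in>{0<..}. principal {(z, w). dist z w < e})"

definition open_complexification :: "'a complexification set \<Rightarrow> bool" where
  "open_complexification U \<longleftrightarrow> (\<forall>x\<in>U. eventually (\<lambda>(x', y). x' = x \<longrightarrow> y \<in> U) uniformity)"

lemma complexification_parts [simp]:
  "re_part (0 :: 'a complexification) = 0" "im_part (0 :: 'a complexification) = 0"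
  "re_part (z + w) = re_part z + re_part w" "im_part (z + w) = im_part z + im_part w"
  "re_part (z - w) = re_part z - re_part w" "im_part (z - w) = im_part z - im_part w"
  "re_part (- z) = - re_part z" "im_part (- z) = - im_part z"
  "re_part (r *\<^sub>R z) = r *\<^sub>R re_part z" "im_part (r *\<^sub>R z) = r *\<^sub>R im_part z"
  "re_part (c *\<^sub>C z) = Re c *\<^sub>R re_part z - Im c *\<^sub>R im_part z"
  "im_part (c *\<^sub>C z) = Re c *\<^sub>R im_part z + Im c *\<^sub>R re_part z"
  for z w :: "'a complexification"
  by (simp_all add: zero_complexification_def plus_complexification_def
      minus_complexification_def uminus_complexification_def scaleR_complexification_def
      scaleC_complexification_def)

lemma modulus_triangle: "modulus (z + w) \<le> modulus z + modulus (w :: 'a complexification)"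
proof (rule modulus_least)
  fix t
  have "rotated_re (z + w) t = rotated_re z t + rotated_re w t"
    by (simp add: rotated_re_def algebra_simps)
  also have "\<dots> \<le> modulus z + modulus w" by (intro add_mono modulus_upper)
  finally show "rotated_re (z + w) t \<le> modulus z + modulus w" .
qed

lemma modulus_scaleC_le: "modulus (c *\<^sub>C z) \<le> cmod c *\<^sub>R modulus (z :: 'a complexification)"
proof (rule modulus_least)
  fix t
  have c: "Re c = cmod c * cos (Arg c)" "Im c = cmod c * sin (Arg c)"
    by (metis Re_rcis rcis_cmod_Arg, metis Im_rcis rcis_cmod_Arg)
  have "rotated_re (c *\<^sub>C z) t = (Re c * cos t + Im c * sin t) *\<^sub>R re_part z +
      (Re c * sin t - Im c * cos t) *\<^sub>R im_part z"
    by (simp add: rotated_re_def algebra_simps)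
  also have "Re c * cos t + Im c * sin t = cmod c * cos (t - Arg c)"
    by (simp add: c cos_diff algebra_simps)
  also have "Re c * sin t - Im c * cos t = cmod c * sin (t - Arg c)"
    by (simp add: c sin_diff algebra_simps)
  finally have "rotated_re (c *\<^sub>C z) t = cmod c *\<^sub>R rotated_re z (t - Arg c)"
    by (simp add: rotated_re_def algebra_simps)
  then show "rotated_re (c *\<^sub>C z) t \<le> cmod c *\<^sub>R modulus z"
    by (simp add: scaleR_left_mono modulus_upper)
qed

instance
proof
  fix z w v :: "'a complexification" and r s :: real and c d :: complex
  show "z + w + v = z + (w + v)" "z + w = w + z" "0 + z = z" "- z + z = 0" "z - w = z + - w"
    "r *\<^sub>R (z + w) = r *\<^sub>R z + r *\<^sub>R w" "(r + s) *\<^sub>R z = r *\<^sub>R z + s *\<^sub>R z"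
    "r *\<^sub>R s *\<^sub>R z = (r * s) *\<^sub>R z" "1 *\<^sub>R z = z"
    "c *\<^sub>C (z + w) = c *\<^sub>C z + c *\<^sub>C w" "(c + d) *\<^sub>C z = c *\<^sub>C z + d *\<^sub>C z"
    by (rule complexification_eqI; simp add: algebra_simps)+
  show ofr: "of_real r *\<^sub>C z = r *\<^sub>R z" for r and z :: "'a complexification"
    by (rule complexification_eqI) simp_all
  show scsc: "c *\<^sub>C d *\<^sub>C z = (c * d) *\<^sub>C z" for c d and z :: "'a complexification"
    by (rule complexification_eqI; simp add: algebra_simps)
  show "dist z w = norm (z - w)" by (rule dist_complexification_def)
  show "sgn z = inverse (norm z) *\<^sub>R z" by (rule sgn_complexification_def)
  show "(uniformity :: ('a complexification \<times> 'a complexification) filter) =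
      (INF e\<in>{0<..}. principal {(z, w). dist z w < e})"
    by (rule uniformity_complexification_def)
  show "open U \<longleftrightarrow> (\<forall>x\<in>U. eventually (\<lambda>(x', y). x' = x \<longrightarrow> y \<in> U) uniformity)"
    for U :: "'a complexification set"
    by (rule open_complexification_def)
  show "norm z = 0 \<longleftrightarrow> z = 0"
  proof
    assume "norm z = 0"
    then have "modulus z = 0" by (simp add: norm_complexification_def)
    with abs_re_part_le[of z] abs_im_part_le[of z] show "z = 0"
      by (intro complexification_eqI) auto
  next
    assume "z = 0"
    then have "modulus z \<le> 0" using modulus_le_sum[of z] by simp
    then have "modulus z = 0" by (intro antisym) auto
    then show "norm z = 0" by (simp add: norm_complexification_def)
  qed
  show "norm (z + w) \<le> norm z + norm w"
    using norm_mono_pos[OF modulus_nonneg modulus_triangle[of z w]]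
      norm_triangle_ineq[of "modulus z" "modulus w"]
    unfolding norm_complexification_def by simp
  have le: "norm (c *\<^sub>C z) \<le> cmod c * norm z" for c and z :: "'a complexification"
    using norm_mono_pos[OF modulus_nonneg modulus_scaleC_le[of c z]]
    unfolding norm_complexification_def by simp
  show nC: "norm (c *\<^sub>C z) = cmod c * norm z" for c and z :: "'a complexification"
  proof (cases "c = 0")
    case True
    then show ?thesis
      using le[of c z] by (simp add: norm_complexification_def antisym)
  next
    case False
    have "inverse c *\<^sub>C c *\<^sub>C z = z"
      using False ofr[of 1 z] unfolding scsc
      by (simp add: complexification_eqI)
    then have "norm z \<le> cmod (inverse c) * norm (c *\<^sub>C z)" by (metis le)
    then have "cmod c * norm z \<le> norm (c *\<^sub>C z)"
      using False by (simp add: norm_inverse norm_divide field_simps)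
    with le[of c z] show ?thesis by simp
  qed
  show "norm (r *\<^sub>R z) = \<bar>r\<bar> * norm z"
    unfolding ofr[symmetric] nC by simp
qed

end

instance complexification :: (banach_lattice) banach
proof
  fix X :: "nat \<Rightarrow> 'a complexification"
  assume X: "Cauchy X"
  have re: "norm (re_part z) \<le> norm z" and im: "norm (im_part z) \<le> norm z"
    and sum: "norm z \<le> norm (re_part z) + norm (im_part z)" for z :: "'a complexification"
    using norm_mono_pos[OF abs_ge_zero abs_re_part_le[of z]]
      norm_mono_pos[OF abs_ge_zero abs_im_part_le[of z]]
      norm_mono_pos[OF modulus_nonneg modulus_le_sum[of z]]
      norm_triangle_ineq[of "\<bar>re_part z\<bar>" "\<bar>im_part z\<bar>"]
    unfolding norm_complexification_def by simp_all
  have "Cauchy (\<lambda>n. re_part (X n))" "Cauchy (\<lambda>n. im_part (X n))"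
    using X re im unfolding Cauchy_iff
    by (metis complexification_parts(5) order_le_less_trans,
        metis complexification_parts(6) order_le_less_trans)
  then obtain x y where xy: "(\<lambda>n. re_part (X n)) \<longlonglongrightarrow> x" "(\<lambda>n. im_part (X n)) \<longlonglongrightarrow> y"
    using Cauchy_convergent convergent_def by metis
  have "(\<lambda>n. norm (re_part (X n) - x) + norm (im_part (X n) - y)) \<longlonglongrightarrow> 0 + 0"
    using xy by (intro tendsto_add tendsto_norm_zero LIM_zero)
  then have lim: "(\<lambda>n. norm (re_part (X n) - x) + norm (im_part (X n) - y)) \<longlonglongrightarrow> 0"
    by simp
  have "norm (X n - Cpx x y) \<le> norm (re_part (X n) - x) + norm (im_part (X n) - y)" for n
    using sum[of "X n - Cpx x y"] by simp
  then have "(\<lambda>n. X n - Cpx x y) \<longlonglongrightarrow> 0"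
    by (intro Lim_null_comparison[OF _ lim] always_eventually) blast
  then show "convergent X"
    unfolding convergent_def using LIM_zero_cancel by blast
qed

definition pos_cone :: "'a::banach_lattice complexification set" where
  "pos_cone = {z. 0 \<le> re_part z \<and> im_part z = 0}"


section \<open>Unbounded operators, spectrum and resolvent\<close>

text \<open>A linear operator with domain \<open>D\<close> is given by the set \<open>D\<close> and a function \<open>A\<close> of which only the
  values on \<open>D\<close> matter.\<close>

definition linear_operator ::
    "'e::complex_normed_vector set \<Rightarrow> ('e \<Rightarrow> 'e) \<Rightarrow> bool" where
  "linear_operator D A \<longleftrightarrow> complex_vector.subspace D \<and>
     (\<forall>f\<in>D. \<forall>g\<in>D. A (f + g) = A f + A g) \<and> (\<forall>c. \<forall>f\<in>D. A (c *\<^sub>C f) = c *\<^sub>C A f)"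

definition resolvent_set ::
    "'e::complex_normed_vector set \<Rightarrow> ('e \<Rightarrow> 'e) \<Rightarrow> complex set" where
  "resolvent_set D A = {\<mu>. bij_betw (\<lambda>f. \<mu> *\<^sub>C f - A f) D UNIV \<and>
     bounded_linear (inv_into D (\<lambda>f. \<mu> *\<^sub>C f - A f))}"

definition spectrum ::
    "'e::complex_normed_vector set \<Rightarrow> ('e \<Rightarrow> 'e) \<Rightarrow> complex set" where
  "spectrum D A = - resolvent_set D A"

definition resolvent ::
    "'e::complex_normed_vector set \<Rightarrow> ('e \<Rightarrow> 'e) \<Rightarrow> complex \<Rightarrow> 'e \<Rightarrow>\<^sub>L 'e" where
  "resolvent D A \<mu> = Blinfun (inv_into D (\<lambda>f. \<mu> *\<^sub>C f - A f))"

text \<open>A pole of order \<open>n \<ge> 1\<close>: an isolated point of the spectrum around which the resolvent has a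
  Laurent expansion, convergent in operator norm, with leading term of degree \<open>-n\<close>.
  The library predicate \<open>is_pole\<close> (norm tending to infinity) is not suitable here, since for
  operator-valued maps it also holds at essential singularities of the resolvent.\<close>

definition resolvent_pole ::
    "'e::complex_normed_vector set \<Rightarrow> ('e \<Rightarrow> 'e) \<Rightarrow> complex \<Rightarrow> bool" where
  "resolvent_pole D A \<mu>0 \<longleftrightarrow> (\<exists>r>0. \<exists>n\<ge>1. \<exists>Q :: nat \<Rightarrow> 'e \<Rightarrow>\<^sub>L 'e. Q 0 \<noteq> 0 \<and>
     (\<forall>\<mu>. 0 < cmod (\<mu> - \<mu>0) \<and> cmod (\<mu> - \<mu>0) < r \<longrightarrow> \<mu> \<in> resolvent_set D A \<and>
       (\<lambda>k. ((\<mu> - \<mu>0) powi (int k - int n)) *\<^sub>C Q k) sums resolvent D A \<mu>))"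

definition eigenspace ::
    "'e::complex_normed_vector set \<Rightarrow> ('e \<Rightarrow> 'e) \<Rightarrow> complex \<Rightarrow> 'e set" where
  "eigenspace D A \<mu> = {f \<in> D. \<mu> *\<^sub>C f - A f = 0}"

definition eigenvalue ::
    "'e::complex_normed_vector set \<Rightarrow> ('e \<Rightarrow> 'e) \<Rightarrow> complex \<Rightarrow> bool" where
  "eigenvalue D A \<mu> \<longleftrightarrow> (\<exists>f\<in>D. f \<noteq> 0 \<and> A f = \<mu> *\<^sub>C f)"


section \<open>Dual space and dual operator\<close>

text \<open>The type \<open>'e \<Rightarrow>\<^sub>L complex\<close> contains all bounded real-linear maps; the dual space
  consists of the complex-linear ones.\<close>

definition dual_space :: "('e::complex_normed_vector \<Rightarrow>\<^sub>L complex) set" where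
  "dual_space = {\<phi>. \<forall>c f. blinfun_apply \<phi> (c *\<^sub>C f) = c * blinfun_apply \<phi> f}"

definition dual_dom ::
    "'e::complex_normed_vector set \<Rightarrow> ('e \<Rightarrow> 'e) \<Rightarrow> ('e \<Rightarrow>\<^sub>L complex) set" where
  "dual_dom D A = {\<phi> \<in> dual_space. \<exists>\<psi>\<in>dual_space. \<forall>f\<in>D. blinfun_apply \<psi> f = blinfun_apply \<phi> (A f)}"

text \<open>Uniqueness of the functional below holds when \<open>D\<close> is dense; the definition is only
  meaningful then.\<close>

definition dual_op ::
    "'e::complex_normed_vector set \<Rightarrow> ('e \<Rightarrow> 'e) \<Rightarrow> ('e \<Rightarrow>\<^sub>L complex) \<Rightarrow> 'e \<Rightarrow>\<^sub>L complex" where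
  "dual_op D A \<phi> =
     (THE \<psi>. \<psi> \<in> dual_space \<and> (\<forall>f\<in>D. blinfun_apply \<psi> f = blinfun_apply \<phi> (A f)))"

definition dual_pos_cone :: "('a::banach_lattice complexification \<Rightarrow>\<^sub>L complex) set" where
  "dual_pos_cone = {\<phi> \<in> dual_space. \<forall>f\<in>pos_cone. blinfun_apply \<phi> f \<in> \<real>\<^sub>\<ge>\<^sub>0}"

end

theory Submission
  imports Defs
begin

text \<open>Let \<open>n \<ge> 1\<close> be the order of the pole and \<open>Q \<noteq> 0\<close> the leading coefficient of the Laurent
  expansion, that is, the limit of \<open>(\<mu> - \<mu>0) ^ n R(\<mu>)\<close> as \<open>\<mu>\<close> decreases to \<open>\<mu>0\<close>.  Since the
  distance to the cone is positively homogeneous and \<open>n \<ge> 1\<close>, the hypothesis on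
  \<open>(\<mu> - \<mu>0) dist (R(\<mu>) f, E\<^sub>+)\<close> puts \<open>Q f\<close> at distance zero from \<open>E\<^sub>+\<close> for each \<open>f \<ge> 0\<close>; the cone is
  closed, so \<open>Q\<close> is a positive operator (\<open>coeff_preserves_pos_cone\<close>).  The cone spans the space,
  hence some \<open>f \<ge> 0\<close> has \<open>Q f \<noteq> 0\<close>.

  Passing to the limit in the resolvent equation shows that \<open>Q\<close> maps into the eigenspace of \<open>\<mu>0\<close>
  (\<open>coeff_range_in_eigenspace\<close>), so \<open>Q f\<close> is the required eigenvector of \<open>A\<close>.  Passing to the limit in
  \<open>R(\<mu>) (\<mu> - A) g = g\<close> shows that \<open>Q (\<mu>0 - A) = 0\<close> on the domain (\<open>coeff_annihilates_range\<close>), so that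
  \<open>\<phi> \<circ> Q\<close> lies in the dual eigenspace for every functional \<open>\<phi>\<close>.  If \<open>\<phi>\<close> is positive then so is
  \<open>\<phi> \<circ> Q\<close>, and it remains to choose a positive \<open>\<phi>\<close> that does not vanish at \<open>Q f\<close>.

  Such a \<open>\<phi>\<close> is the Hahn-Banach extension of a functional dominated by the norm of the positive
  part (\<open>positive_functional_exists\<close>).  The extension theorem is derived in the form that a minimal
  sublinear functional is linear, which needs only functionals defined on the whole space.\<close>

section \<open>Dominated extension of linear functionals\<close>

definition sublinear :: "('v::real_vector \<Rightarrow> real) \<Rightarrow> bool" where
  "sublinear q \<longleftrightarrow> (\<forall>x y. q (x + y) \<le> q x + q y) \<and> (\<forall>r\<ge>0. \<forall>x. q (r *\<^sub>R x) = r * q x)"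

lemma sublinear_add: "sublinear q \<Longrightarrow> q (x + y) \<le> q x + q y"
  and sublinear_scaleR: "sublinear q \<Longrightarrow> 0 \<le> r \<Longrightarrow> q (r *\<^sub>R x) = r * q x"
  by (simp_all add: sublinear_def)

lemma sublinear_zero: "sublinear q \<Longrightarrow> q 0 = 0"
  using sublinear_scaleR[of q 0 0] by simp

lemma sublinearI:
  fixes q :: "'v::real_vector \<Rightarrow> real"
  assumes add: "\<And>x y. q (x + y) \<le> q x + q y"
    and scale: "\<And>r x. 0 < r \<Longrightarrow> q (r *\<^sub>R x) \<le> r * q x"
    and zero: "q 0 = 0"
  shows "sublinear q"
  unfolding sublinear_def
proof (intro conjI allI impI add)
  fix r :: real and x assume "0 \<le> r"
  show "q (r *\<^sub>R x) = r * q x"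
  proof (cases "r = 0")
    case False
    with \<open>0 \<le> r\<close> have r: "0 < r" by simp
    have "q (inverse r *\<^sub>R r *\<^sub>R x) \<le> inverse r * q (r *\<^sub>R x)"
      using r by (intro scale) simp
    with r have "r * q x \<le> q (r *\<^sub>R x)" by (simp add: field_simps)
    with scale[OF r, of x] show ?thesis by simp
  qed (simp add: zero)
qed

lemma sublinear_ge_minus:
  assumes "sublinear q"
  shows "- q (- x) \<le> q x"
  using sublinear_add[OF assms, of x "- x"] sublinear_zero[OF assms] by simp

text \<open>The largest sublinear functional below \<open>q\<close> whose value at \<open>- y\<close> is at most \<open>- q y\<close>.  It
  differs from \<open>q\<close> unless \<open>q\<close> is already additive in the direction \<open>y\<close>.\<close>

definition tilt :: "('v::real_vector \<Rightarrow> real) \<Rightarrow> 'v \<Rightarrow> 'v \<Rightarrow> real" where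
  "tilt q y x = (INF t\<in>{0..}. q (x + t *\<^sub>R y) - t * q y)"

lemma tilt_bdd:
  assumes "sublinear q"
  shows "bdd_below ((\<lambda>t. q (x + t *\<^sub>R y) - t * q y) ` {0..})"
proof (rule bdd_belowI2)
  fix t :: real assume "t \<in> {0..}"
  then have "t * q y \<le> q (x + t *\<^sub>R y) + q (- x)"
    using sublinear_add[OF assms, of "x + t *\<^sub>R y" "- x"] sublinear_scaleR[OF assms, of t y] by simp
  then show "- q (- x) \<le> q (x + t *\<^sub>R y) - t * q y" by simp
qed

lemma tilt_le:
  assumes "sublinear q" "0 \<le> t"
  shows "tilt q y x \<le> q (x + t *\<^sub>R y) - t * q y"
  unfolding tilt_def using assms by (intro cINF_lower tilt_bdd) auto

lemma tilt_le_self: "sublinear q \<Longrightarrow> tilt q y x \<le> q x"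
  using tilt_le[of q 0 y x] by simp

lemma le_tilt: "(\<And>t. 0 \<le> t \<Longrightarrow> v \<le> q (x + t *\<^sub>R y) - t * q y) \<Longrightarrow> v \<le> tilt q y x"
  unfolding tilt_def by (rule cINF_greatest) auto

lemma sublinear_tilt:
  assumes q: "sublinear q"
  shows "sublinear (tilt q y)"
proof (rule sublinearI)
  fix u v
  have "tilt q y (u + v) - (q (v + s *\<^sub>R y) - s * q y) \<le> tilt q y u" if s: "0 \<le> s" for s
  proof (rule le_tilt)
    fix t :: real assume t: "0 \<le> t"
    have "tilt q y (u + v) \<le> q ((u + v) + (t + s) *\<^sub>R y) - (t + s) * q y"
      using s t by (intro tilt_le q) simp
    also have "q ((u + v) + (t + s) *\<^sub>R y) \<le> q (u + t *\<^sub>R y) + q (v + s *\<^sub>R y)"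
      using sublinear_add[OF q, of "u + t *\<^sub>R y" "v + s *\<^sub>R y"] by (simp add: algebra_simps)
    finally show "tilt q y (u + v) - (q (v + s *\<^sub>R y) - s * q y) \<le> q (u + t *\<^sub>R y) - t * q y"
      by (simp add: algebra_simps)
  qed
  then have "tilt q y (u + v) - tilt q y u \<le> tilt q y v"
    by (intro le_tilt) (simp add: algebra_simps)
  then show "tilt q y (u + v) \<le> tilt q y u + tilt q y v" by simp
next
  fix r :: real and x assume r: "0 < r"
  have "inverse r * tilt q y (r *\<^sub>R x) \<le> tilt q y x"
  proof (rule le_tilt)
    fix t :: real assume t: "0 \<le> t"
    have "tilt q y (r *\<^sub>R x) \<le> q (r *\<^sub>R x + (r * t) *\<^sub>R y) - (r * t) * q y"
      using r t by (intro tilt_le q) simp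
    also have "r *\<^sub>R x + (r * t) *\<^sub>R y = r *\<^sub>R (x + t *\<^sub>R y)" by (simp add: scaleR_add_right)
    finally show "inverse r * tilt q y (r *\<^sub>R x) \<le> q (x + t *\<^sub>R y) - t * q y"
      using r sublinear_scaleR[OF q, of r "x + t *\<^sub>R y"] by (simp add: field_simps del: scaleR_add_right)
  qed
  with r show "tilt q y (r *\<^sub>R x) \<le> r * tilt q y x" by (simp add: field_simps)
next
  have "q (0 + t *\<^sub>R y) - t * q y = 0" if "0 \<le> t" for t
    using sublinear_scaleR[OF q that] by simp
  then show "tilt q y 0 = 0"
    using tilt_le_self[OF q, of y 0] sublinear_zero[OF q] by (intro antisym le_tilt) auto
qed

text \<open>A minimal sublinear functional coincides with each of its tilts, which makes it additive.\<close>

lemma minimal_sublinear_linear: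
  assumes q: "sublinear q"
    and min: "\<And>s. sublinear s \<Longrightarrow> s \<le> q \<Longrightarrow> s = q"
  shows "linear q"
proof -
  have "tilt q y = q" for y
    by (intro min sublinear_tilt q le_funI tilt_le_self)
  then have "q x \<le> q (x + y) - q y" for x y
    using tilt_le[OF q, of 1 y x] by simp
  then have add: "q (x + y) = q x + q y" for x y
    using sublinear_add[OF q, of x y] by (smt (verit))
  have neg: "q (- x) = - q x" for x
    using add[of x "- x"] sublinear_zero[OF q] by simp
  show ?thesis
  proof (rule linearI)
    fix r :: real and x
    show "q (r *\<^sub>R x) = r *\<^sub>R q x"
    proof (cases "0 \<le> r")
      case False
      then have "q ((- r) *\<^sub>R x) = - r * q x" by (intro sublinear_scaleR q) simp
      then show ?thesis using neg[of "r *\<^sub>R x"] by simp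
    qed (simp add: sublinear_scaleR q)
  qed (rule add)
qed

text \<open>A chain of sublinear functionals below \<open>p\<close> is pointwise bounded below, by \<open>- p (- x)\<close>, and
  its pointwise infimum is again sublinear; Zorn's lemma then yields a minimal one.\<close>

lemma linear_below_sublinear:
  fixes p :: "'v::real_vector \<Rightarrow> real"
  assumes p: "sublinear p"
  shows "\<exists>\<phi>. linear \<phi> \<and> \<phi> \<le> p"
proof -
  define S where "S = {q. sublinear q \<and> q \<le> p}"
  have "\<exists>m\<in>S. \<forall>q\<in>S. q \<le> m \<longrightarrow> q = m"
  proof (rule predicate_Zorn)
    show "partial_order_on S (relation_of (\<lambda>x y. y \<le> x) S)"
      by (rule partial_order_on_relation_ofI) auto
  next
    fix C assume "C \<in> Chains (relation_of (\<lambda>x y. y \<le> x) S)"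
    then have CS: "C \<subseteq> S" and chain: "\<And>q s. q \<in> C \<Longrightarrow> s \<in> C \<Longrightarrow> q \<le> s \<or> s \<le> q"
      by (auto simp: Chains_def relation_of_def)
    show "\<exists>u\<in>S. \<forall>q\<in>C. u \<le> q"
    proof (cases "C = {}")
      case True
      then show ?thesis using p by (auto simp: S_def)
    next
      case False
      define u where "u x = (INF q\<in>C. q x)" for x
      have sub: "sublinear q" and below: "q x \<le> p x" if "q \<in> C" for q x
        using CS that by (auto simp: S_def le_fun_def)
      have "bdd_below ((\<lambda>q. q x) ` C)" for x
      proof (rule bdd_belowI2)
        fix q assume "q \<in> C"
        then show "- p (- x) \<le> q x"
          using sublinear_ge_minus[OF sub, of q x] below[of q "- x"] by simp
      qed
      then have u_le: "u x \<le> q x" if "q \<in> C" for q x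
        unfolding u_def using that by (rule cINF_lower)
      have le_u: "v \<le> u x" if "\<And>q. q \<in> C \<Longrightarrow> v \<le> q x" for v x
        unfolding u_def using False that by (rule cINF_greatest)
      have "sublinear u"
      proof (rule sublinearI)
        fix x y
        have both: "u (x + y) \<le> q x + s y" if qs: "q \<in> C" "s \<in> C" for q s
        proof -
          obtain w where w: "w \<in> C" "w \<le> q" "w \<le> s"
            using chain[OF qs] qs by blast
          have "u (x + y) \<le> w x + w y"
            using u_le[OF w(1)] sublinear_add[OF sub[OF w(1)]] order_trans by blast
          also have "\<dots> \<le> q x + s y" using w(2,3) by (auto simp: le_fun_def intro: add_mono)
          finally show ?thesis .
        qed
        have "u (x + y) - s y \<le> u x" if "s \<in> C" for s
          using both[OF _ that] by (intro le_u) (simp add: algebra_simps)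
        then have "u (x + y) - u x \<le> u y" by (intro le_u) (simp add: algebra_simps)
        then show "u (x + y) \<le> u x + u y" by simp
      next
        fix r :: real and x assume r: "0 < r"
        have "inverse r * u (r *\<^sub>R x) \<le> u x"
        proof (rule le_u)
          fix q assume q: "q \<in> C"
          show "inverse r * u (r *\<^sub>R x) \<le> q x"
            using u_le[OF q, of "r *\<^sub>R x"] sublinear_scaleR[OF sub[OF q], of r x] r
            by (simp add: field_simps)
        qed
        with r show "u (r *\<^sub>R x) \<le> r * u x" by (simp add: field_simps)
      next
        have "q 0 = 0" if "q \<in> C" for q using sublinear_zero[OF sub[OF that]] .
        then have "u 0 = (INF q\<in>C. 0)" unfolding u_def by (intro INF_cong) auto
        with False show "u 0 = 0" by simp
      qed
      moreover have "u \<le> p"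
      proof (rule le_funI)
        fix x
        obtain q where "q \<in> C" using False by blast
        then show "u x \<le> p x" using u_le below order_trans by blast
      qed
      ultimately show ?thesis using u_le by (auto simp: S_def le_fun_def)
    qed
  qed
  then obtain m where m: "sublinear m" "m \<le> p" and min: "\<And>q. q \<in> S \<Longrightarrow> q \<le> m \<Longrightarrow> q = m"
    by (auto simp: S_def)
  have "linear m"
  proof (rule minimal_sublinear_linear[OF m(1)])
    fix s assume "sublinear s" "s \<le> m"
    with m(2) show "s = m" by (intro min) (auto simp: S_def)
  qed
  with m(2) show ?thesis by blast
qed

text \<open>A linear functional below the tilt of \<open>p\<close> along \<open>g\<close> is at most \<open>- p g\<close> at \<open>- g\<close>, which forces
  equality at \<open>g\<close>.\<close>

lemma linear_touching_sublinear:
  fixes p :: "'v::real_vector \<Rightarrow> real"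
  assumes p: "sublinear p"
  shows "\<exists>\<phi>. linear \<phi> \<and> (\<forall>x. \<phi> x \<le> p x) \<and> \<phi> g = p g"
proof -
  obtain \<phi> where \<phi>: "linear \<phi>" "\<phi> \<le> tilt p g"
    using linear_below_sublinear[OF sublinear_tilt[OF p]] by blast
  have le: "\<phi> x \<le> p x" for x
    using \<phi>(2) tilt_le_self[OF p, of g x] by (auto simp: le_fun_def intro: order_trans)
  have "\<phi> (- g) \<le> - p g"
    using \<phi>(2) tilt_le[OF p, of 1 g "- g"] sublinear_zero[OF p] 
    by (fastforce simp: le_fun_def intro: order_trans)
  then have "\<phi> g = p g" using le[of g] linear_neg[OF \<phi>(1), of g] by simp
  with \<phi>(1) le show ?thesis by blast
qed

text \<open>The sublinear functional \<open>x \<mapsto> norm (sup x 0)\<close> vanishes on the negative cone, so that every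
  linear functional below it is positive, and it is at most the norm, so that the functional is
  bounded.\<close>

lemma positive_functional_exists:
  fixes g :: "'a::banach_lattice"
  assumes "0 \<le> g"
  shows "\<exists>\<phi>. bounded_linear \<phi> \<and> (\<forall>x\<ge>0. 0 \<le> \<phi> x) \<and> \<phi> g = norm g"
proof -
  define p where "p x = norm (sup x 0)" for x :: 'a
  have "sublinear p"
  proof (rule sublinearI)
    fix x y :: 'a
    have "sup (x + y) 0 \<le> sup x 0 + sup y 0"
      by (intro sup_least add_mono add_nonneg_nonneg) auto
    then have "p (x + y) \<le> norm (sup x 0 + sup y 0)"
      unfolding p_def by (intro norm_mono_pos) auto
    also have "\<dots> \<le> p x + p y" unfolding p_def by (rule norm_triangle_ineq)
    finally show "p (x + y) \<le> p x + p y" .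
  next
    fix r :: real and x :: 'a assume r: "0 < r"
    have "sup (r *\<^sub>R x) 0 \<le> r *\<^sub>R sup x 0"
      using r scaleR_left_mono[of x "sup x 0" r] scaleR_left_mono[of 0 "sup x 0" r]
      by (intro sup_least) auto
    then have "p (r *\<^sub>R x) \<le> norm (r *\<^sub>R sup x 0)"
      unfolding p_def by (intro norm_mono_pos) auto
    with r show "p (r *\<^sub>R x) \<le> r * p x" by (simp add: p_def)
  qed (simp add: p_def)
  then obtain \<phi> where \<phi>: "linear \<phi>" "\<And>x. \<phi> x \<le> p x" "\<phi> g = p g"
    using linear_touching_sublinear by blast
  have p_le: "p x \<le> norm x" for x
  proof -
    have "sup x 0 \<le> \<bar>x\<bar>" by (simp add: abs_ge_self)
    then show ?thesis unfolding p_def using norm_mono_pos[of "sup x 0" "\<bar>x\<bar>"] by simp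
  qed
  have "bounded_linear \<phi>"
  proof (rule bounded_linear_intro[where K = 1])
    fix x
    show "norm (\<phi> x) \<le> norm x * 1"
      using \<phi>(2)[of x] \<phi>(2)[of "- x"] p_le[of x] p_le[of "- x"] linear_neg[OF \<phi>(1), of x] by simp
  qed (simp_all add: linear_add[OF \<phi>(1)] linear_scale[OF \<phi>(1)])
  moreover have "0 \<le> \<phi> x" if "0 \<le> x" for x
  proof -
    have "sup (- x) 0 = 0" using that by (simp add: sup_absorb2)
    then show ?thesis using \<phi>(2)[of "- x"] linear_neg[OF \<phi>(1), of x] by (simp add: p_def)
  qed
  moreover have "\<phi> g = norm g" using \<phi>(3) assms by (simp add: p_def sup_absorb1)
  ultimately show ?thesis by blast
qed


section \<open>The positive cone of the complexification\<close>

lemma norm_re_part_le: "norm (re_part z) \<le> norm z"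
  and norm_im_part_le: "norm (im_part z) \<le> norm z"
  using norm_mono_pos[OF abs_ge_zero abs_re_part_le[of z]]
    norm_mono_pos[OF abs_ge_zero abs_im_part_le[of z]]
  unfolding norm_complexification_def by simp_all

lemma bounded_linear_re_part: "bounded_linear re_part"
  by (rule bounded_linear_intro[where K = 1]) (simp_all add: norm_re_part_le)

lemma bounded_linear_im_part: "bounded_linear im_part"
  by (rule bounded_linear_intro[where K = 1]) (simp_all add: norm_im_part_le)

lemma zero_in_pos_cone: "0 \<in> pos_cone"
  by (simp add: pos_cone_def)

lemma pos_cone_scaleR: "z \<in> pos_cone \<Longrightarrow> 0 \<le> r \<Longrightarrow> r *\<^sub>R z \<in> pos_cone"
  by (simp add: pos_cone_def scaleR_nonneg_nonneg)

lemma closed_pos_cone: "closed (pos_cone :: 'a::banach_lattice complexification set)"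
  unfolding closed_sequential_limits
proof (intro allI impI, elim conjE)
  fix X :: "nat \<Rightarrow> 'a complexification" and z
  assume X: "\<forall>n. X n \<in> pos_cone" and lim: "X \<longlonglongrightarrow> z"
  have "0 \<le> re_part z"
    using bounded_linear.tendsto[OF bounded_linear_re_part lim]
    by (rule pos_cone_limit) (use X in \<open>simp add: pos_cone_def\<close>)
  moreover have "im_part z = 0"
  proof (rule LIMSEQ_unique)
    show "(\<lambda>n. im_part (X n)) \<longlonglongrightarrow> im_part z"
      by (rule bounded_linear.tendsto[OF bounded_linear_im_part lim])
    show "(\<lambda>n. im_part (X n)) \<longlonglongrightarrow> 0" using X by (simp add: pos_cone_def)
  qed
  ultimately show "z \<in> pos_cone" by (simp add: pos_cone_def)
qed

lemma infdist_scaleR_pos_cone_le: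
  fixes z :: "'a::banach_lattice complexification"
  assumes r: "0 < r"
  shows "infdist (r *\<^sub>R z) pos_cone \<le> r * infdist z pos_cone"
proof -
  have ne: "pos_cone \<noteq> ({} :: 'a complexification set)" using zero_in_pos_cone by blast
  have "inverse r * infdist (r *\<^sub>R z) pos_cone \<le> infdist z pos_cone"
    unfolding infdist_notempty[OF ne, of z]
  proof (rule cINF_greatest[OF ne])
    fix w :: "'a complexification" assume "w \<in> pos_cone"
    then have "infdist (r *\<^sub>R z) pos_cone \<le> dist (r *\<^sub>R z) (r *\<^sub>R w)"
      using r by (intro infdist_le pos_cone_scaleR) auto
    also have "\<dots> = r * dist z w"
      using r by (simp add: dist_norm flip: scaleR_diff_right)
    finally show "inverse r * infdist (r *\<^sub>R z) pos_cone \<le> dist z w"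
      using r by (simp add: field_simps)
  qed
  with r show ?thesis by (simp add: field_simps)
qed

text \<open>Every vector is a complex combination of four positive ones: the positive and negative parts
  of its real and imaginary parts.\<close>

lemma positive_vector_not_annihilated:
  fixes T :: "'a::banach_lattice complexification \<Rightarrow>\<^sub>L 'b::complex_normed_vector"
  assumes T: "\<And>c f. blinfun_apply T (c *\<^sub>C f) = c *\<^sub>C blinfun_apply T f" and "T \<noteq> 0"
  shows "\<exists>f\<in>pos_cone. blinfun_apply T f \<noteq> 0"
proof (rule ccontr)
  assume "\<not> ?thesis"
  then have zero: "blinfun_apply T f = 0" if "f \<in> pos_cone" for f using that by blast
  have real: "blinfun_apply T (Cpx x 0) = 0" for x
  proof -
    have "Cpx x 0 = Cpx (pprt x) 0 - Cpx (- nprt x) 0"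
      by (rule complexification_eqI) (simp_all flip: prts)
    then show ?thesis by (simp add: blinfun.diff_right zero pos_cone_def)
  qed
  have "blinfun_apply T z = 0" for z
  proof -
    have "z = Cpx (re_part z) 0 + \<i> *\<^sub>C Cpx (im_part z) 0"
      by (rule complexification_eqI) simp_all
    then have "blinfun_apply T z = blinfun_apply T (Cpx (re_part z) 0) + \<i> *\<^sub>C blinfun_apply T (Cpx (im_part z) 0)"
      by (metis T blinfun.add_right)
    then show ?thesis by (simp add: real)
  qed
  then have "T = 0" by (intro blinfun_eqI) simp
  with \<open>T \<noteq> 0\<close> show False by simp
qed

text \<open>A positive functional \<open>\<phi>\<close> on the real lattice extends complex-linearly by
  \<open>x + i y \<mapsto> \<phi> x + i \<phi> y\<close>; on the cone only the first term is present, so positivity and the value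
  at \<open>g\<close> carry over.\<close>

lemma dual_pos_cone_separates:
  fixes g :: "'a::banach_lattice complexification"
  assumes g: "g \<in> pos_cone" "g \<noteq> 0"
  shows "\<exists>\<phi>\<in>dual_pos_cone. blinfun_apply \<phi> g \<noteq> 0"
proof -
  obtain \<phi> where \<phi>: "bounded_linear \<phi>" "\<And>x. 0 \<le> x \<Longrightarrow> 0 \<le> \<phi> x" "\<phi> (re_part g) = norm (re_part g)"
    using positive_functional_exists[of "re_part g"] g(1) by (auto simp: pos_cone_def)
  interpret \<phi>: bounded_linear \<phi> by (rule \<phi>(1))
  define F where "F z = Complex (\<phi> (re_part z)) (\<phi> (im_part z))" for z
  have F_eq: "F z = of_real (\<phi> (re_part z)) + \<i> * of_real (\<phi> (im_part z))" for z
    by (simp add: F_def complex_eq_iff)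
  have "bounded_linear F"
    unfolding F_eq
    by (intro bounded_linear_add bounded_linear_const_mult
        bounded_linear_compose[OF bounded_linear_of_real] bounded_linear_compose[OF \<phi>(1)]
        bounded_linear_re_part bounded_linear_im_part)
  then have F: "blinfun_apply (Blinfun F) = F" by (rule bounded_linear_Blinfun_apply)
  have "Blinfun F \<in> dual_space"
    by (simp add: dual_space_def F) (simp add: F_def complex_eq_iff \<phi>.diff \<phi>.add \<phi>.scaleR)
  moreover have "F f \<in> \<real>\<^sub>\<ge>\<^sub>0" if "f \<in> pos_cone" for f
    using that \<phi>(2) by (simp add: pos_cone_def F_def \<phi>.zero complex_nonneg_Reals_iff)
  moreover have "re_part g \<noteq> 0"
    using g by (auto simp: pos_cone_def intro: complexification_eqI)
  then have "F g \<noteq> 0" using \<phi>(3) by (simp add: F_def complex_eq_iff)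
  ultimately show ?thesis by (intro bexI[of _ "Blinfun F"]) (simp_all add: F dual_pos_cone_def)
qed


section \<open>The leading Laurent coefficient of the resolvent\<close>

text \<open>The terms of a convergent series are bounded at one radius \<open>\<rho>\<close>, so that near the centre the
  terms of positive degree are dominated by a geometric series with small ratio.\<close>

lemma power_series_right_limit:
  fixes c :: "nat \<Rightarrow> 'b::banach"
  assumes r: "0 < r"
    and sums: "\<And>t. a < t \<Longrightarrow> t < a + r \<Longrightarrow> (\<lambda>k. (t - a) ^ k *\<^sub>R c k) sums h t"
  shows "(h \<longlongrightarrow> c 0) (at_right a)"
proof -
  define \<rho> where "\<rho> = r / 2"
  have \<rho>: "0 < \<rho>" "\<rho> < r" using r by (simp_all add: \<rho>_def)
  have "summable (\<lambda>k. \<rho> ^ k *\<^sub>R c k)"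
    using sums[of "a + \<rho>"] \<rho> by (auto simp: sums_iff)
  then have "Bseq (\<lambda>k. \<rho> ^ k *\<^sub>R c k)"
    by (intro convergent_imp_Bseq convergentI[OF summable_LIMSEQ_zero])
  then obtain M where M: "\<And>k. norm (\<rho> ^ k *\<^sub>R c k) \<le> M" by (auto simp: Bseq_def)
  have bound: "norm (h t - c 0) \<le> 2 * M * ((t - a) / \<rho>)" if t: "a < t" "t < a + \<rho> / 2" for t
  proof -
    define s where "s = (t - a) / \<rho>"
    have s: "0 < s" "s < 1 / 2" using t \<rho> by (simp_all add: s_def field_simps)
    have ts: "t - a = s * \<rho>" using \<rho> by (simp add: s_def)
    have "(\<lambda>k. (t - a) ^ k *\<^sub>R c k) sums h t" using t \<rho> by (intro sums) auto
    then have "(\<lambda>k. (t - a) ^ Suc k *\<^sub>R c (Suc k)) sums (h t - c 0)"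
      by (subst sums_Suc_iff) simp
    then have h: "h t - c 0 = (\<Sum>k. (t - a) ^ Suc k *\<^sub>R c (Suc k))" by (simp add: sums_iff)
    have "norm ((t - a) ^ Suc k *\<^sub>R c (Suc k)) \<le> s * M * s ^ k" for k
    proof -
      have "norm ((t - a) ^ Suc k *\<^sub>R c (Suc k)) = s ^ Suc k * norm (\<rho> ^ Suc k *\<^sub>R c (Suc k))"
        using s \<rho> by (simp add: ts power_mult_distrib abs_mult)
      also have "\<dots> \<le> s ^ Suc k * M" using s by (intro mult_left_mono M) simp
      finally show ?thesis by (simp add: mult_ac)
    qed
    moreover have "(\<lambda>k. s * M * s ^ k) sums (s * M * (1 / (1 - s)))"
      using s by (intro sums_mult geometric_sums) simp
    ultimately have "norm (h t - c 0) \<le> s * M * (1 / (1 - s))"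
      using norm_suminf_le[of "\<lambda>k. (t - a) ^ Suc k *\<^sub>R c (Suc k)" "\<lambda>k. s * M * s ^ k"]
      unfolding h sums_iff by metis
    also have "\<dots> \<le> s * M * 2"
    proof (rule mult_left_mono)
      show "1 / (1 - s) \<le> 2" using s by (simp add: field_simps)
      show "0 \<le> s * M" using s order_trans[OF norm_ge_zero M] by simp
    qed
    finally show ?thesis by (simp add: s_def mult_ac)
  qed
  have "((\<lambda>t. h t - c 0) \<longlongrightarrow> 0) (at_right a)"
  proof (rule Lim_null_comparison)
    have "\<forall>\<^sub>F t in at_right a. t \<in> {a<..<a + \<rho> / 2}"
      using \<rho> by (intro eventually_at_right_real) simp
    then show "\<forall>\<^sub>F t in at_right a. norm (h t - c 0) \<le> 2 * M * ((t - a) / \<rho>)"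
      by eventually_elim (rule bound; simp)
    have "((\<lambda>t. 2 * M * ((t - a) / \<rho>)) \<longlongrightarrow> 2 * M * ((a - a) / \<rho>)) (at_right a)"
      using \<rho> by (intro tendsto_intros) auto
    then show "((\<lambda>t. 2 * M * ((t - a) / \<rho>)) \<longlongrightarrow> 0) (at_right a)" by simp
  qed
  then show ?thesis by (rule Lim_null[THEN iffD2])
qed

lemma resolvent_apply:
  assumes "\<mu> \<in> resolvent_set D A"
  shows "blinfun_apply (resolvent D A \<mu>) = inv_into D (\<lambda>f. \<mu> *\<^sub>C f - A f)"
  using assms by (simp add: resolvent_def resolvent_set_def bounded_linear_Blinfun_apply)

lemma resolvent_in_domain:
  assumes "\<mu> \<in> resolvent_set D A"
  shows "blinfun_apply (resolvent D A \<mu>) f \<in> D"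
  unfolding resolvent_apply[OF assms]
  using assms by (intro inv_into_into) (simp add: resolvent_set_def bij_betw_def)

lemma resolvent_right_inverse:
  assumes "\<mu> \<in> resolvent_set D A"
  shows "\<mu> *\<^sub>C blinfun_apply (resolvent D A \<mu>) f - A (blinfun_apply (resolvent D A \<mu>) f) = f"
  unfolding resolvent_apply[OF assms]
  using assms f_inv_into_f[of f "\<lambda>f. \<mu> *\<^sub>C f - A f" D]
  by (simp add: resolvent_set_def bij_betw_def)

lemma resolvent_left_inverse:
  assumes "\<mu> \<in> resolvent_set D A" "f \<in> D"
  shows "blinfun_apply (resolvent D A \<mu>) (\<mu> *\<^sub>C f - A f) = f"
  unfolding resolvent_apply[OF assms(1)]
  using assms inv_into_f_f[of "\<lambda>f. \<mu> *\<^sub>C f - A f" D f]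
  by (simp add: resolvent_set_def bij_betw_def)

lemma resolvent_scaleC:
  assumes A: "linear_operator D A" and \<mu>: "\<mu> \<in> resolvent_set D A"
  shows "blinfun_apply (resolvent D A \<mu>) (c *\<^sub>C f) = c *\<^sub>C blinfun_apply (resolvent D A \<mu>) f"
proof -
  define g where "g = blinfun_apply (resolvent D A \<mu>) f"
  have g: "g \<in> D" "\<mu> *\<^sub>C g - A g = f"
    by (simp_all add: g_def resolvent_in_domain[OF \<mu>] resolvent_right_inverse[OF \<mu>])
  have cg: "c *\<^sub>C g \<in> D" "A (c *\<^sub>C g) = c *\<^sub>C A g"
    using A g(1) by (auto simp: linear_operator_def complex_vector.subspace_scale)
  have "c *\<^sub>C f = \<mu> *\<^sub>C (c *\<^sub>C g) - A (c *\<^sub>C g)"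
    unfolding g(2)[symmetric] cg(2) complex_vector.scale_right_diff_distrib
    by (simp add: scaleC_scaleC mult.commute)
  then show ?thesis
    using resolvent_left_inverse[OF \<mu> cg(1)] by (simp add: g_def)
qed

text \<open>Only the behaviour of the resolvent on the real axis to the right of \<open>\<mu>0\<close> is recorded.
  There \<open>Q\<close> is the limit of \<open>(\<mu> - \<mu>0) ^ n R(\<mu>)\<close>, and each of the properties of \<open>Q\<close> below arises
  by passing to the limit in an identity for \<open>R(\<mu>)\<close>.\<close>

locale resolvent_leading_coeff =
  fixes D :: "'e::complex_normed_vector set" and A :: "'e \<Rightarrow> 'e"
    and \<mu>0 :: real and n :: nat and Q :: "'e \<Rightarrow>\<^sub>L 'e"
  assumes lin: "linear_operator D A"
    and order_pos: "1 \<le> n"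
    and resolvent_near: "\<forall>\<^sub>F \<mu> in at_right \<mu>0. complex_of_real \<mu> \<in> resolvent_set D A"
    and coeff_limit:
      "((\<lambda>\<mu>. (\<mu> - \<mu>0) ^ n *\<^sub>R resolvent D A (complex_of_real \<mu>)) \<longlongrightarrow> Q) (at_right \<mu>0)"
begin

abbreviation Res :: "real \<Rightarrow> 'e \<Rightarrow> 'e" where
  "Res \<mu> \<equiv> blinfun_apply (resolvent D A (complex_of_real \<mu>))"

lemma scaled_resolvent_limit:
  "(X \<longlongrightarrow> f) (at_right \<mu>0) \<Longrightarrow>
    ((\<lambda>\<mu>. (\<mu> - \<mu>0) ^ n *\<^sub>R Res \<mu> (X \<mu>)) \<longlongrightarrow> blinfun_apply Q f) (at_right \<mu>0)"
  using blinfun.tendsto[OF coeff_limit, of X f] by (simp add: blinfun.scaleR_left)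

lemma power_limit_zero: "((\<lambda>\<mu>. (\<mu> - \<mu>0) ^ n) \<longlongrightarrow> 0) (at_right \<mu>0)"
proof -
  have "((\<lambda>\<mu>. (\<mu> - \<mu>0) ^ n) \<longlongrightarrow> (\<mu>0 - \<mu>0) ^ n) (at_right \<mu>0)"
    by (intro tendsto_intros)
  moreover have "(\<mu>0 - \<mu>0) ^ n = 0" using order_pos by simp
  ultimately show ?thesis by metis
qed

lemma coeff_scaleC: "blinfun_apply Q (c *\<^sub>C f) = c *\<^sub>C blinfun_apply Q f"
proof (rule tendsto_unique)
  show "((\<lambda>\<mu>. (\<mu> - \<mu>0) ^ n *\<^sub>R Res \<mu> (c *\<^sub>C f)) \<longlongrightarrow> blinfun_apply Q (c *\<^sub>C f)) (at_right \<mu>0)"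
    by (intro scaled_resolvent_limit tendsto_const)
  have "((\<lambda>\<mu>. c *\<^sub>C ((\<mu> - \<mu>0) ^ n *\<^sub>R Res \<mu> f)) \<longlongrightarrow> c *\<^sub>C blinfun_apply Q f) (at_right \<mu>0)"
    by (intro bounded_linear.tendsto[OF bounded_linear_scaleC_right] scaled_resolvent_limit
        tendsto_const)
  then show "((\<lambda>\<mu>. (\<mu> - \<mu>0) ^ n *\<^sub>R Res \<mu> (c *\<^sub>C f)) \<longlongrightarrow> c *\<^sub>C blinfun_apply Q f) (at_right \<mu>0)"
  proof (rule Lim_transform_eventually)
    show "\<forall>\<^sub>F \<mu> in at_right \<mu>0.
        c *\<^sub>C ((\<mu> - \<mu>0) ^ n *\<^sub>R Res \<mu> f) = (\<mu> - \<mu>0) ^ n *\<^sub>R Res \<mu> (c *\<^sub>C f)"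
      using resolvent_near
      by eventually_elim
        (simp add: resolvent_scaleC[OF lin] bounded_linear.linear[OF bounded_linear_scaleC_right] linear_scale)
  qed
qed simp

text \<open>On \<open>D\<close> the operator \<open>R(\<mu>) (\<mu> - A)\<close> is the identity, and multiplication by \<open>(\<mu> - \<mu>0) ^ n\<close>
  makes the identity vanish in the limit.\<close>

lemma coeff_annihilates_range:
  assumes f: "f \<in> D"
  shows "blinfun_apply Q (\<mu>0 *\<^sub>R f - A f) = 0"
proof (rule tendsto_unique)
  show "((\<lambda>\<mu>. (\<mu> - \<mu>0) ^ n *\<^sub>R Res \<mu> (\<mu> *\<^sub>R f - A f)) \<longlongrightarrow> blinfun_apply Q (\<mu>0 *\<^sub>R f - A f)) (at_right \<mu>0)"
    by (intro scaled_resolvent_limit tendsto_intros)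
  have "((\<lambda>\<mu>. (\<mu> - \<mu>0) ^ n *\<^sub>R f) \<longlongrightarrow> 0) (at_right \<mu>0)"
    using tendsto_scaleR[OF power_limit_zero tendsto_const, of f] by simp
  then show "((\<lambda>\<mu>. (\<mu> - \<mu>0) ^ n *\<^sub>R Res \<mu> (\<mu> *\<^sub>R f - A f)) \<longlongrightarrow> 0) (at_right \<mu>0)"
  proof (rule Lim_transform_eventually)
    show "\<forall>\<^sub>F \<mu> in at_right \<mu>0. (\<mu> - \<mu>0) ^ n *\<^sub>R f = (\<mu> - \<mu>0) ^ n *\<^sub>R Res \<mu> (\<mu> *\<^sub>R f - A f)"
      using resolvent_near
    proof eventually_elim
      case (elim \<mu>)
      show ?case using resolvent_left_inverse[OF elim f] by (simp add: scaleC_of_real)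
    qed
  qed
qed simp

text \<open>For a fixed \<open>\<nu>\<close> in the resolvent set, the resolvent equation
  \<open>R(\<nu>) + (\<nu> - \<mu>) R(\<nu>) R(\<mu>) = R(\<mu>)\<close> becomes \<open>(\<nu> - \<mu>0) R(\<nu>) Q = Q\<close> in the limit.  Hence the
  range of \<open>Q\<close> lies in \<open>D\<close>, and applying \<open>\<nu> - A\<close> shows that \<open>A\<close> acts on it as \<open>\<mu>0\<close>.\<close>

lemma coeff_range_in_eigenspace:
  "blinfun_apply Q f \<in> D" "A (blinfun_apply Q f) = \<mu>0 *\<^sub>R blinfun_apply Q f"
proof -
  obtain \<nu> where "\<mu>0 < \<nu>" and \<nu>: "complex_of_real \<nu> \<in> resolvent_set D A"
  proof -
    have "\<forall>\<^sub>F \<mu> in at_right \<mu>0. \<mu>0 < \<mu> \<and> complex_of_real \<mu> \<in> resolvent_set D A"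
      using resolvent_near eventually_at_right_less by (rule eventually_conj[rotated])
    from eventually_happens[OF this] that show thesis by auto
  qed
  have eq: "Res \<nu> f + (\<nu> - \<mu>) *\<^sub>R Res \<nu> (Res \<mu> f) = Res \<mu> f"
    if \<mu>: "complex_of_real \<mu> \<in> resolvent_set D A" for \<mu>
  proof -
    have "\<nu> *\<^sub>R Res \<mu> f - A (Res \<mu> f) = f + (\<nu> - \<mu>) *\<^sub>R Res \<mu> f"
      using resolvent_right_inverse[OF \<mu>, of f] by (simp add: scaleC_of_real algebra_simps)
    then show ?thesis
      using resolvent_left_inverse[OF \<nu> resolvent_in_domain[OF \<mu>], of f]
      by (simp add: scaleC_of_real blinfun.add_right blinfun.scaleR_right)
  qed
  have Q: "(\<nu> - \<mu>0) *\<^sub>R Res \<nu> (blinfun_apply Q f) = blinfun_apply Q f"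
  proof (rule tendsto_unique)
    show "((\<lambda>\<mu>. (\<mu> - \<mu>0) ^ n *\<^sub>R Res \<mu> f) \<longlongrightarrow> blinfun_apply Q f) (at_right \<mu>0)"
      by (intro scaled_resolvent_limit tendsto_const)
    have "((\<lambda>\<mu>. (\<mu> - \<mu>0) ^ n *\<^sub>R Res \<nu> f) \<longlongrightarrow> 0) (at_right \<mu>0)"
      using tendsto_scaleR[OF power_limit_zero tendsto_const, of "Res \<nu> f"] by simp
    moreover have "((\<lambda>\<mu>. (\<nu> - \<mu>) *\<^sub>R Res \<nu> ((\<mu> - \<mu>0) ^ n *\<^sub>R Res \<mu> f))
        \<longlongrightarrow> (\<nu> - \<mu>0) *\<^sub>R Res \<nu> (blinfun_apply Q f)) (at_right \<mu>0)"
      by (intro tendsto_intros scaled_resolvent_limit)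
    ultimately have "((\<lambda>\<mu>. (\<mu> - \<mu>0) ^ n *\<^sub>R Res \<nu> f + (\<nu> - \<mu>) *\<^sub>R Res \<nu> ((\<mu> - \<mu>0) ^ n *\<^sub>R Res \<mu> f))
        \<longlongrightarrow> 0 + (\<nu> - \<mu>0) *\<^sub>R Res \<nu> (blinfun_apply Q f)) (at_right \<mu>0)"
      by (rule tendsto_add)
    then show "((\<lambda>\<mu>. (\<mu> - \<mu>0) ^ n *\<^sub>R Res \<mu> f)
        \<longlongrightarrow> (\<nu> - \<mu>0) *\<^sub>R Res \<nu> (blinfun_apply Q f)) (at_right \<mu>0)"
      unfolding add_0_left
    proof (rule Lim_transform_eventually)
      show "\<forall>\<^sub>F \<mu> in at_right \<mu>0.
          (\<mu> - \<mu>0) ^ n *\<^sub>R Res \<nu> f + (\<nu> - \<mu>) *\<^sub>R Res \<nu> ((\<mu> - \<mu>0) ^ n *\<^sub>R Res \<mu> f) =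
          (\<mu> - \<mu>0) ^ n *\<^sub>R Res \<mu> f"
        using resolvent_near
      proof eventually_elim
        case (elim \<mu>)
        show ?case
          using arg_cong[OF eq[OF elim], of "\<lambda>x. (\<mu> - \<mu>0) ^ n *\<^sub>R x"]
          by (simp add: blinfun.scaleR_right scaleR_add_right mult.commute)
      qed
    qed
  qed simp
  define g where "g = Res \<nu> (blinfun_apply Q f)"
  have g: "g \<in> D" "complex_of_real \<nu> *\<^sub>C g - A g = blinfun_apply Q f"
    by (simp_all add: g_def resolvent_in_domain[OF \<nu>] resolvent_right_inverse[OF \<nu>])
  have sc: "(\<nu> - \<mu>0) *\<^sub>R g \<in> D" "A ((\<nu> - \<mu>0) *\<^sub>R g) = (\<nu> - \<mu>0) *\<^sub>R A g"
    using lin g(1) unfolding scaleC_of_real[symmetric]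
    by (auto simp: linear_operator_def complex_vector.subspace_scale)
  show "blinfun_apply Q f \<in> D" using sc(1) Q by (simp add: g_def)
  have "A (blinfun_apply Q f) = (\<nu> - \<mu>0) *\<^sub>R A g" using sc(2) Q by (simp add: g_def)
  also have "A g = \<nu> *\<^sub>R g - blinfun_apply Q f" using g(2) by (simp add: scaleC_of_real algebra_simps)
  also have "(\<nu> - \<mu>0) *\<^sub>R (\<nu> *\<^sub>R g - blinfun_apply Q f) =
      \<nu> *\<^sub>R ((\<nu> - \<mu>0) *\<^sub>R g) - (\<nu> - \<mu>0) *\<^sub>R blinfun_apply Q f"
    by (simp add: scaleR_diff_right mult.commute)
  also have "\<dots> = \<mu>0 *\<^sub>R blinfun_apply Q f"
    using Q by (simp add: g_def scaleR_diff_left)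
  finally show "A (blinfun_apply Q f) = \<mu>0 *\<^sub>R blinfun_apply Q f" .
qed

end

lemma resolvent_pole_leading_coeff:
  fixes D :: "'a::banach_lattice complexification set"
  assumes A: "linear_operator D A" and pole: "resolvent_pole D A (complex_of_real \<mu>0)"
  obtains n Q where "resolvent_leading_coeff D A \<mu>0 n Q" "Q \<noteq> 0"
proof -
  obtain r n Q where r: "0 < r" and n: "1 \<le> n" and Q0: "Q 0 \<noteq> 0"
    and Q: "\<And>\<mu>. 0 < cmod (\<mu> - complex_of_real \<mu>0) \<Longrightarrow> cmod (\<mu> - complex_of_real \<mu>0) < r \<Longrightarrow>
      \<mu> \<in> resolvent_set D A \<and>
      (\<lambda>k. ((\<mu> - complex_of_real \<mu>0) powi (int k - int n)) *\<^sub>C Q k) sums resolvent D A \<mu>"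
    using pole unfolding resolvent_pole_def by blast
  have cmod: "cmod (complex_of_real \<mu> - complex_of_real \<mu>0) = \<bar>\<mu> - \<mu>0\<bar>" for \<mu>
    by (metis norm_of_real of_real_diff)
  have "resolvent_leading_coeff D A \<mu>0 n (Q 0)"
  proof
    have "\<forall>\<^sub>F \<mu> in at_right \<mu>0. \<mu> \<in> {\<mu>0<..<\<mu>0 + r}"
      using r by (intro eventually_at_right_real) simp
    then show "\<forall>\<^sub>F \<mu> in at_right \<mu>0. complex_of_real \<mu> \<in> resolvent_set D A"
      by eventually_elim (use Q in \<open>simp add: cmod\<close>)
    show "((\<lambda>\<mu>. (\<mu> - \<mu>0) ^ n *\<^sub>R resolvent D A (complex_of_real \<mu>)) \<longlongrightarrow> Q 0) (at_right \<mu>0)"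
    proof (rule power_series_right_limit[OF r])
      fix t assume t: "\<mu>0 < t" "t < \<mu>0 + r"
      define s where "s = t - \<mu>0"
      have s: "0 < s" using t by (simp add: s_def)
      have "(\<lambda>k. (complex_of_real s powi (int k - int n)) *\<^sub>C Q k)
          sums resolvent D A (complex_of_real t)"
        using Q[of "complex_of_real t"] t by (simp add: cmod s_def)
      then have "(\<lambda>k. s ^ n *\<^sub>R (complex_of_real (s powi (int k - int n)) *\<^sub>C Q k))
          sums (s ^ n *\<^sub>R resolvent D A (complex_of_real t))"
        unfolding of_real_power_int by (rule sums_scaleR_right)
      moreover have "s ^ n *\<^sub>R (complex_of_real (s powi (int k - int n)) *\<^sub>C Q k) = s ^ k *\<^sub>R Q k"
        for k
        unfolding scaleC_of_real using s by (simp add: power_int_diff)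
      ultimately show "(\<lambda>k. (t - \<mu>0) ^ k *\<^sub>R Q k) sums
          ((t - \<mu>0) ^ n *\<^sub>R resolvent D A (complex_of_real t))"
        by (simp add: s_def)
    qed
  qed (fact A n)+
  with Q0 show thesis by (rule that[rotated])
qed

text \<open>The hypothesis controls \<open>(\<mu> - \<mu>0) dist (R(\<mu>) f, E\<^sub>+)\<close>.  Since \<open>n \<ge> 1\<close>, the further factor
  \<open>(\<mu> - \<mu>0) ^ (n - 1)\<close> stays bounded, and \<open>Q f\<close> is at distance zero from the closed cone.\<close>

lemma coeff_preserves_pos_cone:
  fixes D :: "'a::banach_lattice complexification set"
  assumes "resolvent_leading_coeff D A \<mu>0 n Q"
    and f: "((\<lambda>\<mu>::real. (\<mu> - \<mu>0) *
          infdist (blinfun_apply (resolvent D A (complex_of_real \<mu>)) f) pos_cone) \<longlongrightarrow> 0)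
        (at_right \<mu>0)"
  shows "blinfun_apply Q f \<in> pos_cone"
proof -
  interpret resolvent_leading_coeff D A \<mu>0 n Q by fact
  let ?g = "\<lambda>\<mu>. (\<mu> - \<mu>0) ^ n *\<^sub>R Res \<mu> f"
  have "((\<lambda>\<mu>. infdist (?g \<mu>) pos_cone) \<longlongrightarrow> infdist (blinfun_apply Q f) pos_cone) (at_right \<mu>0)"
    by (intro tendsto_infdist scaled_resolvent_limit tendsto_const)
  moreover have "((\<lambda>\<mu>. infdist (?g \<mu>) pos_cone) \<longlongrightarrow> 0) (at_right \<mu>0)"
  proof (rule Lim_null_comparison)
    show "\<forall>\<^sub>F \<mu> in at_right \<mu>0.
        norm (infdist (?g \<mu>) pos_cone) \<le> (\<mu> - \<mu>0) ^ (n - 1) * ((\<mu> - \<mu>0) * infdist (Res \<mu> f) pos_cone)"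
      using eventually_at_right_less
    proof eventually_elim
      case (elim \<mu>)
      have "infdist (?g \<mu>) pos_cone \<le> (\<mu> - \<mu>0) ^ n * infdist (Res \<mu> f) pos_cone"
        using elim by (intro infdist_scaleR_pos_cone_le) simp
      also have "\<dots> = (\<mu> - \<mu>0) ^ (n - 1) * ((\<mu> - \<mu>0) * infdist (Res \<mu> f) pos_cone)"
        using order_pos by (simp add: power_eq_if)
      finally show ?case by (simp add: infdist_nonneg)
    qed
    have "((\<lambda>\<mu>. (\<mu> - \<mu>0) ^ (n - 1)) \<longlongrightarrow> (\<mu>0 - \<mu>0) ^ (n - 1)) (at_right \<mu>0)"
      by (intro tendsto_intros)
    from tendsto_mult[OF this f]
    show "((\<lambda>\<mu>. (\<mu> - \<mu>0) ^ (n - 1) * ((\<mu> - \<mu>0) * infdist (Res \<mu> f) pos_cone)) \<longlongrightarrow> 0)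
        (at_right \<mu>0)"
      by simp
  qed
  ultimately have "infdist (blinfun_apply Q f) pos_cone = 0"
    using tendsto_unique trivial_limit_at_right_real by blast
  moreover have "pos_cone \<noteq> ({} :: 'a complexification set)" using zero_in_pos_cone by blast
  ultimately show ?thesis using closed_pos_cone in_closed_iff_infdist_zero by blast
qed


section \<open>The dual operator\<close>

text \<open>Density of \<open>D\<close> enters here: bounded functionals that agree on \<open>D\<close> agree everywhere.\<close>

lemma dual_op_eqI:
  assumes dense: "closure D = UNIV"
    and \<psi>: "\<psi> \<in> dual_space" "\<And>f. f \<in> D \<Longrightarrow> blinfun_apply \<psi> f = blinfun_apply \<phi> (A f)"
  shows "dual_op D A \<phi> = \<psi>"
  unfolding dual_op_def
proof (rule the_equality)
  fix \<eta> assume \<eta>: "\<eta> \<in> dual_space \<and> (\<forall>f\<in>D. blinfun_apply \<eta> f = blinfun_apply \<phi> (A f))"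
  have "blinfun_apply \<eta> f = blinfun_apply \<psi> f" for f
  proof -
    have "blinfun_apply \<eta> f - blinfun_apply \<psi> f = 0"
    proof (rule continuous_constant_on_closure[where S = D])
      show "continuous_on (closure D) (\<lambda>x. blinfun_apply \<eta> x - blinfun_apply \<psi> x)"
        by (intro continuous_intros)
    qed (use \<eta> \<psi> dense in auto)
    then show ?thesis by simp
  qed
  then show "\<eta> = \<psi>" by (rule blinfun_eqI)
qed (use \<psi> in blast)

lemma (in resolvent_leading_coeff) dual_eigenvector:
  assumes dense: "closure D = UNIV" and \<phi>: "\<phi> \<in> dual_space"
  shows "\<phi> o\<^sub>L Q \<in> dual_dom D A" "dual_op D A (\<phi> o\<^sub>L Q) = complex_of_real \<mu>0 *\<^sub>C (\<phi> o\<^sub>L Q)"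
proof -
  have dual: "\<phi> o\<^sub>L Q \<in> dual_space" "complex_of_real \<mu>0 *\<^sub>C (\<phi> o\<^sub>L Q) \<in> dual_space"
    using \<phi> by (simp_all add: dual_space_def coeff_scaleC scaleC_complex_def mult.left_commute)
  have on_D: "blinfun_apply (complex_of_real \<mu>0 *\<^sub>C (\<phi> o\<^sub>L Q)) f = blinfun_apply (\<phi> o\<^sub>L Q) (A f)"
    if "f \<in> D" for f
  proof -
    have "blinfun_apply Q (A f) = \<mu>0 *\<^sub>R blinfun_apply Q f"
      using coeff_annihilates_range[OF that] by (simp add: blinfun.diff_right blinfun.scaleR_right)
    then show ?thesis by (simp add: blinfun.scaleR_right blinfun.scaleR_left scaleC_of_real)
  qed
  show "\<phi> o\<^sub>L Q \<in> dual_dom D A" using dual on_D unfolding dual_dom_def by blast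
  show "dual_op D A (\<phi> o\<^sub>L Q) = complex_of_real \<mu>0 *\<^sub>C (\<phi> o\<^sub>L Q)"
    by (rule dual_op_eqI[OF dense dual(2) on_D])
qed


section \<open>Positive eigenvectors at a pole of the resolvent\<close>

theorem theorem3p1:
  fixes D :: "'a::banach_lattice complexification set"
    and A :: "'a complexification \<Rightarrow> 'a complexification"
    and \<mu>0 :: real
  assumes "linear_operator D A"
    and "complex_of_real \<mu>0 \<in> spectrum D A"
    and "resolvent_pole D A (complex_of_real \<mu>0)"
    and "\<forall>f\<in>pos_cone.
      ((\<lambda>\<mu>::real. (\<mu> - \<mu>0) *
          infdist (blinfun_apply (resolvent D A (complex_of_real \<mu>)) f) pos_cone) \<longlongrightarrow> 0)
        (at_right \<mu>0)"
  shows "(eigenvalue D A (complex_of_real \<mu>0) \<and>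
          (\<exists>f \<in> eigenspace D A (complex_of_real \<mu>0). f \<in> pos_cone \<and> f \<noteq> 0)) \<and>
         (closure D = UNIV \<longrightarrow>
          eigenvalue (dual_dom D A) (dual_op D A) (complex_of_real \<mu>0) \<and>
          (\<exists>\<phi> \<in> eigenspace (dual_dom D A) (dual_op D A) (complex_of_real \<mu>0).
             \<phi> \<in> dual_pos_cone \<and> \<phi> \<noteq> 0))"
proof -
  obtain n Q where coeff: "resolvent_leading_coeff D A \<mu>0 n Q" and Q: "Q \<noteq> 0"
    using resolvent_pole_leading_coeff[OF assms(1,3)] .
  interpret resolvent_leading_coeff D A \<mu>0 n Q by (rule coeff)
  have pos: "blinfun_apply Q f \<in> pos_cone" if "f \<in> pos_cone" for f
    using coeff_preserves_pos_cone[OF coeff] assms(4) that by blast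
  obtain f where f: "f \<in> pos_cone" "blinfun_apply Q f \<noteq> 0"
    using positive_vector_not_annihilated[OF coeff_scaleC Q] by blast
  have eig: "blinfun_apply Q f \<in> D" "A (blinfun_apply Q f) = complex_of_real \<mu>0 *\<^sub>C blinfun_apply Q f"
    using coeff_range_in_eigenspace[of f] by (simp_all add: scaleC_of_real)
  obtain \<phi> where \<phi>: "\<phi> \<in> dual_pos_cone" "blinfun_apply \<phi> (blinfun_apply Q f) \<noteq> 0"
    using dual_pos_cone_separates[OF pos[OF f(1)] f(2)] by blast
  have \<phi>_dual: "\<phi> \<in> dual_space" using \<phi>(1) by (simp add: dual_pos_cone_def)
  have "\<phi> o\<^sub>L Q \<noteq> 0" using \<phi>(2) by (metis blinfun_apply_blinfun_compose zero_blinfun.rep_eq)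
  moreover have "\<phi> o\<^sub>L Q \<in> dual_pos_cone"
    using \<phi>(1) pos by (simp add: dual_pos_cone_def dual_space_def coeff_scaleC)
  ultimately show ?thesis
    using eig f(2) pos[OF f(1)] dual_eigenvector[OF _ \<phi>_dual]
    unfolding eigenvalue_def eigenspace_def by auto
qed

end
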